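(* Let $\Gamma$ be an odd-ordered (finite) abelian group with right regular representation $R$ and symmetric doubling orbit partition $\Gamma'=\{[g]\}_{g\in J}$. Let $G:\mathbb Z_2^\Gamma\to\mathbb Z_2^\Gamma$ be a linear map. Then $G$ is the Gramian of a binary Parseval $\Gamma$-frame if and only if $$G=\sum_{g\in J}\nu([g])R_{[g]}$$ for some $\nu:\Gamma'\to\mathbb Z_2$ with $\nu([e])=1$.
   Context: All vectors and matrices are over the field $\mathbb Z_2$ with two elements. The dot product on $\mathbb Z_2^n$ is $\langle a,b\rangle=\sum_{i=1}^n a_ib_i\in\mathbb Z_2$. A finite family $\{f_j\}_{j\in J}$ in $\mathbb Z_2^n$ is a binary Parseval frame if $x=\sum_{j\in J}\langle x,f_j\rangle f_j$ for all $x\in\mathbb Z_2^n$. For a finite group $\Gamma$ with identity $e$, a family $\{f_g\}_{g\in\Gamma}$ in $\mathbb Z_2^n$ (for some $n$) is a binary Parseval $\Gamma$-frame if it is a binary Parseval frame and there is a representation (group homomorphism) $\rho:\Gamma\to \mathrm{GL}(\mathbb Z_2^n)$ with $f_g=\rho(g)f_e$ for all $g\in\Gamma$. The Gramian of $\{f_g\}_{g\in\Gamma}$ is the linear map on $\mathbb Z_2^\Gamma$ with matrix entries $G_{a,b}=\langle f_b,f_a\rangle$ in the standard basis. The right regular representation acts on functions $\varphi:\Gamma\to\mathbb Z_2$ by $(R_g\varphi)(h)=\varphi(hg)$. For a finite abelian group $\Gamma$ of odd order (so that every element has a unique square root), the symmetric doubling orbit of $g\in\Gamma$ is $[g]:=\{h\in\Gamma: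 g^{2^m}=h\text{ for some }m\in\mathbb N\}\cup\{h\in\Gamma:(g^{-1})^{2^m}=h\text{ for some }m\in\mathbb N\}$, and $R_{[g]}:=\sum_{h\in[g]}R_h$. The collection $\Gamma'=\{[g]\}_{g\in J}$, indexed by representatives $J\subset\Gamma$, is the symmetric doubling orbit partition of $\Gamma$ if $\bigcup_{g\in J}[g]=\Gamma$ and $[g]\ne[h]$ for distinct $g,h\in J$. *)

theory Defs
  imports
    "HOL-Library.Z2"
    "HOL-Library.FuncSet"
    "HOL-Algebra.Coset"
    "Jordan_Normal_Form.Matrix"
begin

text \<open>
  The field with two elements is the type \<^typ>\<open>bit\<close>, and the space of binary vectors of length
  \<open>n\<close> is the set \<^term>\<open>carrier_vec n :: bit vec set\<close>.
\<close>

definition binary_parseval_frame :: "nat \<Rightarrow> 'j set \<Rightarrow> ('j \<Rightarrow> bit vec) \<Rightarrow> bool" where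
  "binary_parseval_frame n J f \<longleftrightarrow>
     finite J \<and> f \<in> J \<rightarrow> carrier_vec n \<and>
     (\<forall>x \<in> carrier_vec n. x = finsum_vec TYPE(bit) n (\<lambda>j. (x \<bullet> f j) \<cdot>\<^sub>v f j) J)"

definition binary_GL :: "nat \<Rightarrow> bit mat monoid" where
  "binary_GL n = units_of (ring_mat TYPE(bit) n ())"

text \<open>
  The dimension \<open>n = 0\<close>, which is degenerate (the zero family is then a Parseval group frame with
  Gramian \<open>0\<close>), is not excluded by this definition and must be excluded where it is used.
\<close>

definition binary_parseval_group_frame ::
    "('g, 'x) monoid_scheme \<Rightarrow> nat \<Rightarrow> ('g \<Rightarrow> bit vec) \<Rightarrow> bool" where
  "binary_parseval_group_frame \<Gamma> n f \<longleftrightarrow>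
     binary_parseval_frame n (carrier \<Gamma>) f \<and>
     (\<exists>\<rho> \<in> hom \<Gamma> (binary_GL n). \<forall>g \<in> carrier \<Gamma>. f g = \<rho> g *\<^sub>v f \<one>\<^bsub>\<Gamma>\<^esub>)"

text \<open>
  A function from the carrier of \<open>\<Gamma>\<close> to the two-element field is encoded as a function on
  the ambient type that vanishes outside the carrier.
\<close>

definition fun_space :: "('g, 'x) monoid_scheme \<Rightarrow> ('g \<Rightarrow> bit) set" where
  "fun_space \<Gamma> = {\<phi>. \<forall>h. h \<notin> carrier \<Gamma> \<longrightarrow> \<phi> h = 0}"

definition linear_map ::
    "('g, 'x) monoid_scheme \<Rightarrow> (('g \<Rightarrow> bit) \<Rightarrow> ('g \<Rightarrow> bit)) \<Rightarrow> bool" where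
  "linear_map \<Gamma> G \<longleftrightarrow>
     G \<in> fun_space \<Gamma> \<rightarrow> fun_space \<Gamma> \<and>
     (\<forall>\<phi> \<in> fun_space \<Gamma>. \<forall>\<psi> \<in> fun_space \<Gamma>. G (\<lambda>h. \<phi> h + \<psi> h) = (\<lambda>h. G \<phi> h + G \<psi> h)) \<and>
     (\<forall>c. \<forall>\<phi> \<in> fun_space \<Gamma>. G (\<lambda>h. c * \<phi> h) = (\<lambda>h. c * G \<phi> h))"

definition std_basis :: "'g \<Rightarrow> 'g \<Rightarrow> bit" where
  "std_basis b = (\<lambda>h. if h = b then 1 else 0)"

definition is_gramian ::
    "('g, 'x) monoid_scheme \<Rightarrow> ('g \<Rightarrow> bit vec) \<Rightarrow> (('g \<Rightarrow> bit) \<Rightarrow> ('g \<Rightarrow> bit)) \<Rightarrow> bool" where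
  "is_gramian \<Gamma> f G \<longleftrightarrow>
     linear_map \<Gamma> G \<and> (\<forall>a \<in> carrier \<Gamma>. \<forall>b \<in> carrier \<Gamma>. G (std_basis b) a = f b \<bullet> f a)"

definition right_regular ::
    "('g, 'x) monoid_scheme \<Rightarrow> 'g \<Rightarrow> ('g \<Rightarrow> bit) \<Rightarrow> ('g \<Rightarrow> bit)" where
  "right_regular \<Gamma> g \<phi> = (\<lambda>h. if h \<in> carrier \<Gamma> then \<phi> (h \<otimes>\<^bsub>\<Gamma>\<^esub> g) else 0)"

definition sym_doubling_orbit :: "('g, 'x) monoid_scheme \<Rightarrow> 'g \<Rightarrow> 'g set" where
  "sym_doubling_orbit \<Gamma> g =
     {h \<in> carrier \<Gamma>. \<exists>m::nat. g [^]\<^bsub>\<Gamma>\<^esub> ((2::nat) ^ m) = h} \<union>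
     {h \<in> carrier \<Gamma>. \<exists>m::nat. (inv\<^bsub>\<Gamma>\<^esub> g) [^]\<^bsub>\<Gamma>\<^esub> ((2::nat) ^ m) = h}"

definition sym_doubling_orbit_representatives ::
    "('g, 'x) monoid_scheme \<Rightarrow> 'g set \<Rightarrow> bool" where
  "sym_doubling_orbit_representatives \<Gamma> J \<longleftrightarrow>
     J \<subseteq> carrier \<Gamma> \<and>
     (\<Union>g\<in>J. sym_doubling_orbit \<Gamma> g) = carrier \<Gamma> \<and>
     (\<forall>g\<in>J. \<forall>h\<in>J. g \<noteq> h \<longrightarrow> sym_doubling_orbit \<Gamma> g \<noteq> sym_doubling_orbit \<Gamma> h)"

definition right_regular_sum ::
    "('g, 'x) monoid_scheme \<Rightarrow> 'g set \<Rightarrow> ('g \<Rightarrow> bit) \<Rightarrow> ('g \<Rightarrow> bit)" where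
  "right_regular_sum \<Gamma> S \<phi> = (\<lambda>a. \<Sum>h\<in>S. right_regular \<Gamma> h \<phi> a)"

end

theory Submission
  imports
    Defs
    "HOL-Algebra.Multiplicative_Group"
    "HOL-Number_Theory.Residues"
begin

text \<open>
  Let \<open>\<eta>(g) = \<langle>f\<^sub>g, f\<^sub>e\<rangle>\<close> for a Parseval group frame. Conjugating the Parseval identity by \<open>\<rho>(h)\<close> shows
  that \<open>\<rho>(h)\<close> is orthogonal, so the Gramian is the convolution matrix \<open>\<eta>(a\<inverse>b)\<close>, and Parseval makes it
  a symmetric idempotent. In the group algebra of an abelian group of odd order over the two-element
  field, \<open>\<eta> * \<eta> = \<eta>\<close> says \<open>\<eta>(g\<^sup>2) = \<eta>(g)\<close>, so \<open>\<eta>\<close> is constant on symmetric doubling orbits; and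
  \<open>\<eta>(e) = 0\<close> would make every frame vector isotropic, which a spanning family cannot be.

  Conversely such an \<open>\<eta>\<close> gives a symmetric idempotent \<open>P\<close> with a nonzero diagonal entry. The dot
  product on its range is nondegenerate and not alternating, so the range has an orthonormal basis
  \<open>u\<^sub>i\<close>. The coordinates of the columns of \<open>P\<close> in this basis form the frame, and translation by \<open>g\<close>
  becomes the matrix \<open>\<rho>(g)\<^sub>i\<^sub>j = \<Sum>\<^sub>a u\<^sub>i(ga) u\<^sub>j(a)\<close>.
\<close>

section \<open>Orthonormal bases of nondegenerate binary spaces\<close>

text \<open>These simp rules would turn field arithmetic on \<^typ>\<open>bit\<close> into Boolean case distinctions.\<close>

declare add_bit_eq_xor [simp del] mult_bit_eq_and [simp del]

lemma bit_add_self [simp]: "x + x = 0" for x :: bit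
  by (cases x) simp_all

lemma bit_mult_self [simp]: "x * x = x" for x :: bit
  by (cases x) simp_all

lemma bit_add_eq_0_iff: "x + y = 0 \<longleftrightarrow> x = y" for x y :: bit
  by (cases x; cases y) simp_all

text \<open>Vectors indexed by \<open>S\<close> are kept as functions on the whole type; their
  values outside \<open>S\<close> are ignored.\<close>

definition dot :: "'a set \<Rightarrow> ('a \<Rightarrow> bit) \<Rightarrow> ('a \<Rightarrow> bit) \<Rightarrow> bit" where
  "dot S x y = (\<Sum>a\<in>S. x a * y a)"

lemma dot_commute: "dot S x y = dot S y x"
  by (simp add: dot_def mult.commute)

lemma dot_add_left: "dot S (\<lambda>a. x a + y a) z = dot S x z + dot S y z"
  by (simp add: dot_def distrib_right sum.distrib)

lemma dot_add_right: "dot S z (\<lambda>a. x a + y a) = dot S z x + dot S z y"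
  by (simp add: dot_def distrib_left sum.distrib)

lemma dot_scale_left: "dot S (\<lambda>a. c * x a) z = c * dot S x z"
  by (simp add: dot_def sum_distrib_left mult.assoc)

lemma dot_scale_right: "dot S z (\<lambda>a. c * x a) = c * dot S z x"
  by (metis dot_commute dot_scale_left)

lemma dot_cong:
  "(\<And>a. a \<in> S \<Longrightarrow> x a = x' a) \<Longrightarrow> (\<And>a. a \<in> S \<Longrightarrow> y a = y' a) \<Longrightarrow> dot S x y = dot S x' y'"
  by (simp add: dot_def)

text \<open>For an idempotent matrix \<open>P\<close> these are exactly the vectors of its
  range.\<close>

definition fixed_by :: "'a set \<Rightarrow> ('a \<Rightarrow> 'a \<Rightarrow> bit) \<Rightarrow> ('a \<Rightarrow> bit) \<Rightarrow> bool" where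
  "fixed_by S P x \<longleftrightarrow> (\<forall>a\<in>S. dot S (P a) x = x a)"

text \<open>By symmetry the dot product of two rows is an entry of the square of \<open>P\<close>,
  so this describes a symmetric idempotent matrix, read on \<open>S\<close> only.\<close>

definition orth_projection :: "'a set \<Rightarrow> ('a \<Rightarrow> 'a \<Rightarrow> bit) \<Rightarrow> bool" where
  "orth_projection S P \<longleftrightarrow>
     (\<forall>a\<in>S. \<forall>b\<in>S. P a b = P b a \<and> dot S (P a) (P b) = P a b)"

lemma fixed_by_add:
  "fixed_by S P x \<Longrightarrow> fixed_by S P y \<Longrightarrow> fixed_by S P (\<lambda>a. x a + y a)"
  by (simp add: fixed_by_def dot_add_right)

lemma fixed_by_row: "orth_projection S P \<Longrightarrow> b \<in> S \<Longrightarrow> fixed_by S P (P b)"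
  by (simp add: fixed_by_def orth_projection_def)

text \<open>Splitting off a unit vector \<open>v\<close> subtracts the rank one matrix v v^T, and
  subtraction is addition here. The new range is the orthogonal complement of \<open>v\<close> in
  the old one.\<close>

lemma orth_projection_deflate:
  assumes P: "orth_projection S P" and v: "fixed_by S P v" "dot S v v = 1"
  shows "orth_projection S (\<lambda>a b. P a b + v a * v b)"
    and "fixed_by S (\<lambda>a b. P a b + v a * v b) x \<Longrightarrow> fixed_by S P x \<and> dot S v x = 0"
    and "fixed_by S P x \<Longrightarrow> dot S v x = 0 \<Longrightarrow> fixed_by S (\<lambda>a b. P a b + v a * v b) x"
proof -
  have Pv: "dot S (P a) v = v a" if "a \<in> S" for a
    using v(1) that by (simp add: fixed_by_def)
  have vP: "dot S v (P a) = v a" if "a \<in> S" for a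
    using Pv[OF that] by (simp add: dot_commute)
  show "orth_projection S (\<lambda>a b. P a b + v a * v b)"
    using P v(2) unfolding orth_projection_def
    by (auto simp: dot_add_left dot_add_right dot_scale_left dot_scale_right Pv vP mult.commute
        add.assoc)
  show "fixed_by S (\<lambda>a b. P a b + v a * v b) x"
    if "fixed_by S P x" "dot S v x = 0"
    using that by (simp add: fixed_by_def dot_add_left dot_scale_left)
  assume fx: "fixed_by S (\<lambda>a b. P a b + v a * v b) x"
  then have eq: "x a = dot S (P a) x + v a * dot S v x" if "a \<in> S" for a
    using that by (simp add: fixed_by_def dot_add_left dot_scale_left)
  \<comment> \<open>\<open>x\<close> is not yet known to lie in the range of \<open>P\<close>, but
    its image under \<open>P\<close> does by idempotence.\<close>
  have PP: "dot S (P a) (\<lambda>b. dot S (P b) x) = dot S (P a) x" if "a \<in> S" for a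
  proof -
    have "dot S (P a) (\<lambda>b. dot S (P b) x) = (\<Sum>b\<in>S. \<Sum>c\<in>S. P a b * (P b c * x c))"
      by (simp add: dot_def sum_distrib_left)
    also have "\<dots> = (\<Sum>c\<in>S. \<Sum>b\<in>S. P a b * (P b c * x c))"
      by (rule sum.swap)
    also have "\<dots> = (\<Sum>c\<in>S. dot S (P a) (P c) * x c)"
      using P unfolding dot_def sum_distrib_right orth_projection_def
      by (intro sum.cong refl) (simp add: mult.assoc)
    also have "\<dots> = dot S (P a) x"
      using P that unfolding dot_def[of S "P a" x]
      by (intro sum.cong refl) (simp add: orth_projection_def)
    finally show ?thesis .
  qed
  \<comment> \<open>Moving the symmetric \<open>P\<close> to the other side of the dot product makes
    it act on \<open>v\<close>, which it fixes.\<close>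
  have vPx: "dot S v (\<lambda>b. dot S (P b) x) = dot S v x"
  proof -
    have "dot S v (\<lambda>b. dot S (P b) x) = (\<Sum>b\<in>S. \<Sum>c\<in>S. v b * (P b c * x c))"
      by (simp add: dot_def sum_distrib_left)
    also have "\<dots> = (\<Sum>c\<in>S. \<Sum>b\<in>S. v b * (P b c * x c))"
      by (rule sum.swap)
    also have "\<dots> = (\<Sum>c\<in>S. dot S v (P c) * x c)"
      using P unfolding dot_def sum_distrib_right orth_projection_def
      by (intro sum.cong refl) (simp add: mult.assoc)
    also have "\<dots> = dot S v x"
      unfolding dot_def[of S v x] by (intro sum.cong refl) (simp add: vP)
    finally show ?thesis .
  qed
  \<comment> \<open>Pairing x = P x + <v,x> v with \<open>v\<close> gives <v,x> = <v,x> + <v,x>,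
    which is 0 in characteristic two.\<close>
  have "dot S v x = dot S v (\<lambda>a. dot S (P a) x + dot S v x * v a)"
    using eq by (intro dot_cong) (simp_all add: mult.commute)
  also have "\<dots> = 0"
    by (simp add: dot_add_right dot_scale_right vPx v(2))
  finally have 0: "dot S v x = 0" .
  with eq have "fixed_by S P x"
    by (simp add: fixed_by_def)
  with 0 show "fixed_by S P x \<and> dot S v x = 0" by simp
qed

text \<open>
  If the part of the range orthogonal to \<open>u\<close> is alternating but contains \<open>p\<close>, \<open>q\<close> with
  \<open>\<langle>p, q\<rangle> = 1\<close>, then \<open>u + p\<close> and \<open>u + q\<close> are orthonormal.
\<close>

lemma orth_projection_step:
  assumes P: "orth_projection S P" and u: "fixed_by S P u" "dot S u u = 1"
    and ab: "a \<in> S" "b \<in> S" "P a b \<noteq> u a * u b"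
  obtains v w where "fixed_by S P v" "dot S v v = 1" "fixed_by S P w" "dot S w w = 1"
    "dot S v w = 0"
proof -
  define Q where "Q = (\<lambda>a b. P a b + u a * u b)"
  have Q: "orth_projection S Q"
    unfolding Q_def by (rule orth_projection_deflate(1)[OF P u])
  have row: "fixed_by S P (Q c)" "dot S u (Q c) = 0" if "c \<in> S" for c
    using orth_projection_deflate(2)[OF P u, of "Q c"] fixed_by_row[OF Q that]
    by (auto simp: Q_def)
  \<comment> \<open>The entry \<open>Q a b\<close> is nonzero by the choice of \<open>a\<close> and
    \<open>b\<close>, and by idempotence it is the dot product of two rows.\<close>
  have pq: "dot S (Q a) (Q b) = 1"
    using Q ab by (simp add: orth_projection_def) (simp add: Q_def bit_add_eq_0_iff flip: bit_not_zero_iff)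
  note f = row(1)[OF ab(1)] row(1)[OF ab(2)]
  have o: "dot S u (Q a) = 0" "dot S u (Q b) = 0" "dot S (Q a) u = 0" "dot S (Q b) u = 0"
    using row(2) ab by (simp_all add: dot_commute[of S _ u])
  \<comment> \<open>A row of \<open>Q\<close> that is not isotropic is itself a unit vector
    orthogonal to \<open>u\<close>; only when both rows are isotropic must \<open>u\<close> be
    modified.\<close>
  consider "dot S (Q a) (Q a) = 1" | "dot S (Q b) (Q b) = 1"
    | "dot S (Q a) (Q a) = 0" "dot S (Q b) (Q b) = 0"
    by (metis bit_not_one_iff)
  then show thesis
  proof cases
    case 1
    with that[OF u f(1)] o show thesis by simp
  next
    case 2
    with that[OF u f(2)] o show thesis by simp
  next
    case 3
    show thesis
      by (rule that[OF fixed_by_add[OF u(1) f(1)] _ fixed_by_add[OF u(1) f(2)]])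
        (use 3 u(2) o pq in \<open>simp_all add: dot_add_left dot_add_right\<close>)
  qed
qed

text \<open>Induction on the size of the range. As long as \<open>P\<close> is not u u^T, the range
  contains two orthonormal vectors \<open>v\<close> and \<open>w\<close>. The first is split off;
  the second remains as the unit vector that the induction hypothesis demands of the smaller range,
  which might otherwise be alternating.\<close>

lemma orth_projection_factorization:
  assumes S: "finite S" and P: "orth_projection S P" and u: "fixed_by S P u" "dot S u u = 1"
  shows "\<exists>n\<ge>1. \<exists>U :: nat \<Rightarrow> 'a \<Rightarrow> bit.
    (\<forall>i<n. \<forall>j<n. dot S (U i) (U j) = of_bool (i = j)) \<and>
    (\<forall>a\<in>S. \<forall>b\<in>S. P a b = (\<Sum>i<n. U i a * U i b))"
proof -
  \<comment> \<open>Setting the values outside \<open>S\<close> to 0 makes the range a finite set of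
    functions, so its cardinality can serve as the measure.\<close>
  define R where "R P = {x. (\<forall>a. a \<notin> S \<longrightarrow> x a = 0) \<and> fixed_by S P x}" for P
  have fin: "finite (R P)" for P
  proof (rule finite_subset)
    show "R P \<subseteq> {x. \<forall>a. (a \<in> S \<longrightarrow> x a \<in> {0, 1}) \<and> (a \<notin> S \<longrightarrow> x a = 0)}"
      by (auto simp: R_def)
    show "finite {x. \<forall>a. (a \<in> S \<longrightarrow> x a \<in> {0 :: bit, 1}) \<and> (a \<notin> S \<longrightarrow> x a = 0)}"
      by (rule finite_set_of_finite_funs[OF S]) simp
  qed
  from P u show ?thesis
  proof (induction "card (R P)" arbitrary: P u rule: less_induct)
    case less
    note P = less.prems(1) and u = less.prems(2,3)
    show ?case
    proof (cases "\<forall>a\<in>S. \<forall>b\<in>S. P a b = u a * u b")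
      case True
      with u(2) show ?thesis
        by (intro exI[of _ 1] conjI exI[of _ "\<lambda>_. u"]) auto
    next
      case False
      then obtain a b where "a \<in> S" "b \<in> S" "P a b \<noteq> u a * u b"
        by blast
      then obtain v w where v: "fixed_by S P v" "dot S v v = 1"
        and w: "fixed_by S P w" "dot S w w = 1" and vw: "dot S v w = 0"
        by (rule orth_projection_step[OF P u])
      define Q where "Q = (\<lambda>a b. P a b + v a * v b)"
      note deflate = orth_projection_deflate[OF P v, folded Q_def]
      \<comment> \<open>\<open>v\<close> itself may be nonzero outside \<open>S\<close>; its
        truncation is the element that separates \<open>R Q\<close> from \<open>R P\<close>.\<close>
      define v' where "v' = (\<lambda>a. if a \<in> S then v a else 0)"
      have v'_eq: "dot S x v' = dot S x v" for x
        by (rule dot_cong) (auto simp: v'_def)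
      have "v' \<in> R P"
        using v(1) by (auto simp: R_def fixed_by_def v'_eq) (auto simp: v'_def)
      moreover have "v' \<notin> R Q"
        using deflate(2)[of v'] v(2) by (auto simp: R_def v'_eq)
      moreover have "R Q \<subseteq> R P"
        using deflate(2) by (auto simp: R_def)
      ultimately have "card (R Q) < card (R P)"
        by (intro psubset_card_mono fin) auto
      from less.hyps[OF this deflate(1) deflate(3)[OF w(1) vw] w(2)]
      obtain n and U :: "nat \<Rightarrow> 'a \<Rightarrow> bit" where n: "n \<ge> 1"
        and U: "\<And>i j. i < n \<Longrightarrow> j < n \<Longrightarrow> dot S (U i) (U j) = of_bool (i = j)"
        and QU: "\<And>a b. a \<in> S \<Longrightarrow> b \<in> S \<Longrightarrow> Q a b = (\<Sum>i<n. U i a * U i b)"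
        by blast
      \<comment> \<open>By orthonormality each basis vector lies in the range of \<open>Q\<close>,
        hence is orthogonal to \<open>v\<close>, so that \<open>v\<close> can be appended to the
        basis.\<close>
      have "fixed_by S Q (U i)" if "i < n" for i
        unfolding fixed_by_def
      proof
        fix a assume a: "a \<in> S"
        have "dot S (Q a) (U i) = (\<Sum>b\<in>S. \<Sum>j<n. U j a * U j b * U i b)"
          by (simp add: dot_def QU a sum_distrib_right)
        also have "\<dots> = (\<Sum>j<n. U j a * dot S (U j) (U i))"
          by (subst sum.swap) (simp add: dot_def sum_distrib_left mult.assoc)
        also have "\<dots> = (\<Sum>j<n. if j = i then U i a else 0)"
          by (rule sum.cong) (use that in \<open>auto simp: U\<close>)
        also have "\<dots> = U i a"
          using that by simp
        finally show "dot S (Q a) (U i) = U i a" .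
      qed
      then have vU: "dot S v (U i) = 0" "dot S (U i) v = 0" if "i < n" for i
        using deflate(2)[of "U i"] that by (auto simp: dot_commute)
      have PU: "P a b = (\<Sum>i<Suc n. (U(n := v)) i a * (U(n := v)) i b)" if "a \<in> S" "b \<in> S" for a b
      proof -
        have "(\<Sum>i<Suc n. (U(n := v)) i a * (U(n := v)) i b) = (\<Sum>i<n. U i a * U i b) + v a * v b"
          by simp
        also have "\<dots> = P a b"
          by (simp add: QU[OF that, symmetric] Q_def add.assoc)
        finally show ?thesis ..
      qed
      have UU: "dot S ((U(n := v)) i) ((U(n := v)) j) = of_bool (i = j)"
        if "i < Suc n" "j < Suc n" for i j
        using that by (cases "i = n"; cases "j = n") (simp_all add: U vU v(2))
      show ?thesis
      proof (intro exI conjI allI impI ballI)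
        show "1 \<le> Suc n" by simp
      qed (fact UU PU)+
    qed
  qed
qed

section \<open>Symmetric doubling orbits\<close>

lemma (in group) sum_left_mult:
  assumes "g \<in> carrier G"
  shows "(\<Sum>a\<in>carrier G. F (g \<otimes> a)) = (\<Sum>a\<in>carrier G. F a)"
  by (rule sum.reindex_bij_witness[of _ "\<lambda>a. inv g \<otimes> a" "\<lambda>a. g \<otimes> a"])
    (use assms in \<open>simp_all add: m_assoc[symmetric]\<close>)

text \<open>Euler's theorem gives 2^(m t) = 1 modulo the group order, with \<open>t\<close> its
  totient, so m (t - 1) further doublings undo the first \<open>m\<close>, for all elements
  alike.\<close>

lemma (in group) iterated_doubling_inverse:
  assumes "finite (carrier G)" "odd (order G)"
  obtains k :: nat where "\<And>x. x \<in> carrier G \<Longrightarrow> (x [^] ((2::nat) ^ m)) [^] ((2::nat) ^ k) = x"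
proof -
  define N where "N = order G"
  define t where "t = totient N"
  have "N > 0"
    using assms by (simp add: N_def order_gt_0_iff_finite)
  then have "t > 0"
    by (simp add: t_def)
  have "coprime (2 ^ m) N"
    using assms(2) by (simp add: N_def coprime_commute)
  then have cong: "[(2 ^ m) ^ t = 1] (mod N)"
    unfolding t_def by (rule euler_theorem)
  have "(x [^] ((2::nat) ^ m)) [^] ((2::nat) ^ (m * (t - 1))) = x" if x: "x \<in> carrier G" for x
  proof -
    have "(2::nat) ^ m * 2 ^ (m * (t - 1)) = (2 ^ m) ^ t"
    proof -
      have "m + m * (t - 1) = m * t"
        using \<open>t > 0\<close> by (cases t) simp_all
      then show ?thesis
        by (simp only: power_add[symmetric] power_mult[symmetric])
    qed
    \<comment> \<open>Rules out the degenerate alternative that a number congruent to 1 is 0, which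
      occurs modulo 1.\<close>
    moreover have "(2 ^ m) ^ t \<noteq> (0 :: nat)"
      by simp
    ultimately obtain q where q: "(2::nat) ^ m * 2 ^ (m * (t - 1)) = q * N + 1"
      using cong unfolding cong_to_1'_nat by auto
    have "x [^] N = \<one>"
      unfolding N_def using x by (rule pow_order_eq_1)
    then have "x [^] (N * q + 1) = x"
      using x by (simp add: nat_pow_mult[symmetric] nat_pow_pow[symmetric])
    then show ?thesis
      using x q by (simp add: nat_pow_pow mult.commute)
  qed
  then show thesis
    by (rule that)
qed

lemma (in group) mem_sym_doubling_orbit_iff:
  assumes "g \<in> carrier G"
  shows "h \<in> sym_doubling_orbit G g \<longleftrightarrow>
    (\<exists>m::nat. h = g [^] ((2::nat) ^ m) \<or> h = inv (g [^] ((2::nat) ^ m)))"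
  using assms by (auto simp: sym_doubling_orbit_def nat_pow_inv)

lemma (in group) sym_doubling_orbit_subset:
  "sym_doubling_orbit G g \<subseteq> carrier G"
  by (auto simp: sym_doubling_orbit_def)

lemma (in group) sym_doubling_orbit_self:
  "g \<in> carrier G \<Longrightarrow> g \<in> sym_doubling_orbit G g"
  by (auto simp: mem_sym_doubling_orbit_iff intro!: exI[of _ 0])

lemma (in group) sym_doubling_orbit_trans:
  assumes "g \<in> carrier G" "h \<in> sym_doubling_orbit G g" "k \<in> sym_doubling_orbit G h"
  shows "k \<in> sym_doubling_orbit G g"
proof -
  have h: "h \<in> carrier G"
    using assms sym_doubling_orbit_subset by blast
  obtain l where l: "h = g [^] ((2::nat) ^ l) \<or> h = inv (g [^] ((2::nat) ^ l))"
    using assms by (auto simp: mem_sym_doubling_orbit_iff)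
  obtain m where m: "k = h [^] ((2::nat) ^ m) \<or> k = inv (h [^] ((2::nat) ^ m))"
    using assms h by (auto simp: mem_sym_doubling_orbit_iff)
  have "(g [^] ((2::nat) ^ l)) [^] ((2::nat) ^ m) = g [^] ((2::nat) ^ (l + m))"
    using assms(1) by (simp add: nat_pow_pow power_add)
  then have "k = g [^] ((2::nat) ^ (l + m)) \<or> k = inv (g [^] ((2::nat) ^ (l + m)))"
    using l m assms(1) by (auto simp: nat_pow_inv)
  then show ?thesis
    unfolding mem_sym_doubling_orbit_iff[OF assms(1)] by blast
qed

text \<open>In odd order further doublings undo those that lead from \<open>g\<close> to
  \<open>h\<close>, and inversion commutes with them.\<close>

lemma (in group) sym_doubling_orbit_sym:
  assumes fin: "finite (carrier G)" "odd (order G)"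
    and gh: "g \<in> carrier G" "h \<in> sym_doubling_orbit G g"
  shows "g \<in> sym_doubling_orbit G h"
proof -
  obtain m where m: "h = g [^] ((2::nat) ^ m) \<or> h = inv (g [^] ((2::nat) ^ m))"
    using gh by (auto simp: mem_sym_doubling_orbit_iff)
  obtain k :: nat where "(g [^] ((2::nat) ^ m)) [^] ((2::nat) ^ k) = g"
    using iterated_doubling_inverse[OF fin, of m] gh(1) by metis
  with m have "g = h [^] ((2::nat) ^ k) \<or> g = inv (h [^] ((2::nat) ^ k))"
    using gh(1) by (auto simp: nat_pow_inv)
  moreover have "h \<in> carrier G"
    using gh(2) sym_doubling_orbit_subset by blast
  ultimately show ?thesis
    using mem_sym_doubling_orbit_iff[of h g] by blast
qed

lemma (in group) sym_doubling_orbit_eq: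
  assumes "finite (carrier G)" "odd (order G)"
    and "g \<in> carrier G" "h \<in> sym_doubling_orbit G g"
  shows "sym_doubling_orbit G h = sym_doubling_orbit G g"
proof -
  have "h \<in> carrier G"
    using assms sym_doubling_orbit_subset by blast
  moreover have "g \<in> sym_doubling_orbit G h"
    by (rule sym_doubling_orbit_sym[OF assms])
  ultimately show ?thesis
    using sym_doubling_orbit_trans[of g h] sym_doubling_orbit_trans[of h g] assms(3,4) by blast
qed

text \<open>Every element of the orbit arises from \<open>g\<close> by repeated squaring and at most
  one inversion.\<close>

lemma (in group) constant_on_sym_doubling_orbit:
  assumes double: "\<And>x. x \<in> carrier G \<Longrightarrow> f (x \<otimes> x) = f x"
    and inv: "\<And>x. x \<in> carrier G \<Longrightarrow> f (inv x) = f x"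
    and gh: "g \<in> carrier G" "h \<in> sym_doubling_orbit G g"
  shows "f h = f g"
proof -
  have "f (g [^] ((2::nat) ^ m)) = f g" for m
  proof (induction m)
    case (Suc m)
    have "g [^] ((2::nat) ^ Suc m) = g [^] ((2::nat) ^ m) \<otimes> g [^] ((2::nat) ^ m)"
      using gh(1) by (simp add: nat_pow_mult mult_2)
    with Suc gh(1) show ?case
      by (simp add: double)
  qed (use gh in simp)
  then show ?thesis
    using gh by (auto simp: mem_sym_doubling_orbit_iff inv)
qed

text \<open>Orbits of distinct representatives are disjoint, so the sum over the group splits along
  them, and the weights are constant on each.\<close>

lemma (in group) sum_sym_doubling_orbits:
  fixes \<nu> :: "'a set \<Rightarrow> bit"
  assumes fin: "finite (carrier G)" "odd (order G)"
    and J: "sym_doubling_orbit_representatives G J"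
  shows "(\<Sum>g\<in>J. \<nu> (sym_doubling_orbit G g) * (\<Sum>h\<in>sym_doubling_orbit G g. F h)) =
    (\<Sum>h\<in>carrier G. \<nu> (sym_doubling_orbit G h) * F h)"
proof -
  have JG: "J \<subseteq> carrier G" and UJ: "(\<Union>g\<in>J. sym_doubling_orbit G g) = carrier G"
    and ne: "\<And>g h. g \<in> J \<Longrightarrow> h \<in> J \<Longrightarrow> g \<noteq> h \<Longrightarrow>
      sym_doubling_orbit G g \<noteq> sym_doubling_orbit G h"
    using J by (auto simp: sym_doubling_orbit_representatives_def)
  have "sym_doubling_orbit G g \<inter> sym_doubling_orbit G h = {}"
    if "g \<in> J" "h \<in> J" "g \<noteq> h" for g h
    using that ne[OF that] JG sym_doubling_orbit_eq[OF fin, of g] sym_doubling_orbit_eq[OF fin, of h]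
    by (metis disjoint_iff subset_iff)
  moreover have "finite J"
    using JG fin(1) by (rule finite_subset)
  moreover have "finite (sym_doubling_orbit G g)" for g
    using sym_doubling_orbit_subset fin(1) by (rule finite_subset)
  ultimately have "(\<Sum>h\<in>carrier G. \<nu> (sym_doubling_orbit G h) * F h) =
      (\<Sum>g\<in>J. \<Sum>h\<in>sym_doubling_orbit G g. \<nu> (sym_doubling_orbit G h) * F h)"
    unfolding UJ[symmetric] by (intro sum.UNION_disjoint) auto
  also have "\<dots> = (\<Sum>g\<in>J. \<nu> (sym_doubling_orbit G g) * (\<Sum>h\<in>sym_doubling_orbit G g. F h))"
    unfolding sum_distrib_left
  proof (intro sum.cong refl)
    fix g h assume "g \<in> J" "h \<in> sym_doubling_orbit G g"
    with JG have "sym_doubling_orbit G h = sym_doubling_orbit G g"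
      by (intro sym_doubling_orbit_eq[OF fin]) auto
    then show "\<nu> (sym_doubling_orbit G h) * F h = \<nu> (sym_doubling_orbit G g) * F h"
      by simp
  qed
  finally show ?thesis ..
qed

text \<open>
  In characteristic two the involution \<open>c \<mapsto> c\<inverse>k\<^sup>2\<close> cancels all terms of the convolution except
  the one at its only fixed point \<open>k\<close>.
\<close>

lemma (in comm_group) convolution_square:
  fixes \<eta> :: "'a \<Rightarrow> bit"
  assumes fin: "finite (carrier G)" "odd (order G)" and k: "k \<in> carrier G"
  shows "(\<Sum>c\<in>carrier G. \<eta> (inv c \<otimes> (k \<otimes> k)) * \<eta> c) = \<eta> k"
proof -
  define \<sigma> where "\<sigma> c = inv c \<otimes> (k \<otimes> k)" for c
  have \<sigma>_closed: "\<sigma> c \<in> carrier G" if "c \<in> carrier G" for c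
    using that k by (simp add: \<sigma>_def)
  have \<sigma>_\<sigma>: "\<sigma> (\<sigma> c) = c" if "c \<in> carrier G" for c
  proof -
    have q: "k \<otimes> k \<in> carrier G"
      using k by simp
    have "inv (inv c \<otimes> (k \<otimes> k)) \<otimes> (k \<otimes> k) = c \<otimes> (inv (k \<otimes> k) \<otimes> (k \<otimes> k))"
      using that q by (simp only: inv_mult inv_inv inv_closed m_assoc)
    also have "\<dots> = c"
      using that q by (simp only: l_inv r_one)
    finally show ?thesis
      by (simp only: \<sigma>_def)
  qed
  have \<sigma>_fixed: "\<sigma> c = c \<longleftrightarrow> c = k" if c: "c \<in> carrier G" for c
  proof
    assume "\<sigma> c = c"
    then have "c \<otimes> c = k \<otimes> k"
      using c k inv_solve_left[of c c "k \<otimes> k"] by (simp add: \<sigma>_def)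
    \<comment> \<open>Squaring is injective because a fixed power map undoes it.\<close>
    moreover obtain j :: nat
      where "\<And>x. x \<in> carrier G \<Longrightarrow> (x [^] ((2::nat) ^ 1)) [^] ((2::nat) ^ j) = x"
      using iterated_doubling_inverse[OF fin] by blast
    moreover have "x [^] ((2::nat) ^ 1) = x \<otimes> x" if "x \<in> carrier G" for x
      using that by (simp add: numeral_2_eq_2)
    ultimately show "c = k"
      using c k by metis
  qed (use k in \<open>simp add: \<sigma>_def m_assoc[symmetric]\<close>)
  \<comment> \<open>\<open>c\<close> and \<open>\<sigma> c\<close> are distinct indices with equal
    terms, so the terms cancel in pairs.\<close>
  have "(\<Sum>c\<in>carrier G - {k}. \<eta> (\<sigma> c) * \<eta> c) = 0"
  proof (rule sum_involution_eq_0)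
    fix c assume c: "c \<in> carrier G - {k}"
    then show "\<eta> (\<sigma> (\<sigma> c)) * \<eta> (\<sigma> c) + \<eta> (\<sigma> c) * \<eta> c = 0"
      by (simp add: \<sigma>_\<sigma> mult.commute)
    have "\<sigma> c \<noteq> k"
      using c k \<sigma>_\<sigma>[of c] \<sigma>_fixed[of k] by auto
    then show "\<sigma> c \<in> carrier G - {k}"
      using c \<sigma>_closed by simp
    show "\<sigma> (\<sigma> c) = c" "\<sigma> c \<noteq> c"
      using c \<sigma>_\<sigma> \<sigma>_fixed by auto
  qed
  then have "(\<Sum>c\<in>carrier G. \<eta> (\<sigma> c) * \<eta> c) = \<eta> (\<sigma> k) * \<eta> k"
    using fin(1) k by (simp add: sum.remove)
  also have "\<dots> = \<eta> k"
    using \<sigma>_fixed[OF k] by (cases "\<eta> k") simp_all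
  finally show ?thesis
    by (simp add: \<sigma>_def)
qed

section \<open>Orbit sums of translations and matrices of linear maps\<close>

text \<open>The substitution c = a h turns the orbit sum into a matrix whose entry at (a, c) is the
  weight of the orbit of a^-1 c.\<close>

lemma (in group) sum_orbits_right_regular:
  assumes fin: "finite (carrier G)" "odd (order G)"
    and J: "sym_doubling_orbit_representatives G J"
  shows "(\<Sum>g\<in>J. \<nu> (sym_doubling_orbit G g) *
      right_regular_sum G (sym_doubling_orbit G g) \<phi> a) =
    (if a \<in> carrier G then
       \<Sum>c\<in>carrier G. \<nu> (sym_doubling_orbit G (inv a \<otimes> c)) * \<phi> c else 0)"
proof -
  have "(\<Sum>g\<in>J. \<nu> (sym_doubling_orbit G g) *
      right_regular_sum G (sym_doubling_orbit G g) \<phi> a) =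
      (\<Sum>h\<in>carrier G. \<nu> (sym_doubling_orbit G h) * right_regular G h \<phi> a)"
    unfolding right_regular_sum_def by (rule sum_sym_doubling_orbits[OF fin J])
  also have "\<dots> = (if a \<in> carrier G then
       \<Sum>c\<in>carrier G. \<nu> (sym_doubling_orbit G (inv a \<otimes> c)) * \<phi> c else 0)"
  proof (cases "a \<in> carrier G")
    case True
    have "(\<Sum>h\<in>carrier G. \<nu> (sym_doubling_orbit G h) * right_regular G h \<phi> a) =
        (\<Sum>h\<in>carrier G. \<nu> (sym_doubling_orbit G (inv a \<otimes> (a \<otimes> h))) * \<phi> (a \<otimes> h))"
      using True by (intro sum.cong refl) (simp add: right_regular_def m_assoc[symmetric])
    also have "\<dots> = (\<Sum>c\<in>carrier G. \<nu> (sym_doubling_orbit G (inv a \<otimes> c)) * \<phi> c)"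
      by (rule sum_left_mult[OF True])
    finally show ?thesis
      using True by simp
  qed (simp add: right_regular_def)
  finally show ?thesis .
qed

text \<open>Additivity is given for two summands, so the basis expansion of \<open>\<phi>\<close> is
  built up by induction over finite sets of basis vectors.\<close>

lemma linear_map_expand:
  assumes fin: "finite (carrier \<Gamma>)" and G: "linear_map \<Gamma> G" and \<phi>: "\<phi> \<in> fun_space \<Gamma>"
  shows "G \<phi> a = (\<Sum>b\<in>carrier \<Gamma>. \<phi> b * G (std_basis b) a)"
proof -
  have add: "G (\<lambda>h. \<phi> h + \<psi> h) = (\<lambda>h. G \<phi> h + G \<psi> h)"
    if "\<phi> \<in> fun_space \<Gamma>" "\<psi> \<in> fun_space \<Gamma>" for \<phi> \<psi>
    using G that by (simp add: linear_map_def)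
  have scale: "G (\<lambda>h. c * \<phi> h) = (\<lambda>h. c * G \<phi> h)" if "\<phi> \<in> fun_space \<Gamma>" for c \<phi>
    using G that by (simp add: linear_map_def)
  have basis: "std_basis b \<in> fun_space \<Gamma>" if "b \<in> carrier \<Gamma>" for b
    using that by (auto simp: std_basis_def fun_space_def)
  have "G (\<lambda>h. \<Sum>b\<in>T. \<phi> b * std_basis b h) = (\<lambda>a. \<Sum>b\<in>T. \<phi> b * G (std_basis b) a)"
    if "finite T" "T \<subseteq> carrier \<Gamma>" for T
    using that
  proof (induction T)
    case empty
    \<comment> \<open>That \<open>G\<close> preserves 0 is homogeneity with the scalar 0.\<close>
    have "(\<lambda>_. 0) \<in> fun_space \<Gamma>"
      by (simp add: fun_space_def)
    from scale[OF this, of 0] show ?case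
      by simp
  next
    case (insert b T)
    have "(\<lambda>h. \<phi> b * std_basis b h) \<in> fun_space \<Gamma>"
      using basis[of b] insert.prems by (auto simp: fun_space_def)
    moreover have "(\<lambda>h. \<Sum>b\<in>T. \<phi> b * std_basis b h) \<in> fun_space \<Gamma>"
      using basis insert.prems by (auto simp: fun_space_def intro!: sum.neutral)
    ultimately show ?case
      using insert by (simp add: add scale basis)
  qed
  from this[OF fin subset_refl]
  have "G (\<lambda>h. \<Sum>b\<in>carrier \<Gamma>. \<phi> b * std_basis b h) a =
      (\<Sum>b\<in>carrier \<Gamma>. \<phi> b * G (std_basis b) a)"
    by simp
  moreover have "(\<lambda>h. \<Sum>b\<in>carrier \<Gamma>. \<phi> b * std_basis b h) = \<phi>"
    using fin \<phi> by (auto simp: fun_eq_iff std_basis_def fun_space_def if_distrib[of "(*) _"] cong: if_cong)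
  ultimately show ?thesis
    by simp
qed

text \<open>Reduces an identity of linear maps to entries on the standard basis. The value 0 off the
  carrier matches the encoding of \<open>fun_space\<close>.\<close>

lemma linear_map_matrix_iff:
  assumes fin: "finite (carrier \<Gamma>)" and G: "linear_map \<Gamma> G"
  shows "(\<forall>\<phi> \<in> fun_space \<Gamma>. G \<phi> =
      (\<lambda>a. if a \<in> carrier \<Gamma> then \<Sum>c\<in>carrier \<Gamma>. M a c * \<phi> c else 0)) \<longleftrightarrow>
    (\<forall>a \<in> carrier \<Gamma>. \<forall>b \<in> carrier \<Gamma>. G (std_basis b) a = M a b)"
    (is "?L \<longleftrightarrow> ?R")
proof
  assume L: ?L
  show ?R
  proof (intro ballI)
    fix a b assume a: "a \<in> carrier \<Gamma>" and b: "b \<in> carrier \<Gamma>"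
    have "std_basis b \<in> fun_space \<Gamma>"
      using b by (auto simp: std_basis_def fun_space_def)
    with L a have "G (std_basis b) a = (\<Sum>c\<in>carrier \<Gamma>. M a c * std_basis b c)"
      by simp
    also have "\<dots> = (\<Sum>c\<in>carrier \<Gamma>. if c = b then M a c else 0)"
      by (intro sum.cong refl) (simp add: std_basis_def)
    also have "\<dots> = M a b"
      using fin b by simp
    finally show "G (std_basis b) a = M a b" .
  qed
next
  assume R: ?R
  show ?L
  proof (intro ballI ext)
    fix \<phi> a assume \<phi>: "\<phi> \<in> fun_space \<Gamma>"
    show "G \<phi> a = (if a \<in> carrier \<Gamma> then \<Sum>c\<in>carrier \<Gamma>. M a c * \<phi> c else 0)"
    proof (cases "a \<in> carrier \<Gamma>")
      case True
      with R show ?thesis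
        by (simp add: linear_map_expand[OF fin G \<phi>] mult.commute)
    next
      case False
      moreover have "G \<phi> \<in> fun_space \<Gamma>"
        using G \<phi> by (auto simp: linear_map_def)
      ultimately show ?thesis
        by (simp add: fun_space_def)
    qed
  qed
qed

section \<open>Binary Parseval group frames\<close>

lemma parseval_expansion:
  assumes f: "binary_parseval_frame n J f" and x: "x \<in> carrier_vec n" and i: "i < n"
  shows "x $ i = (\<Sum>j\<in>J. (x \<bullet> f j) * f j $ i)"
proof -
  have J: "finite J" and fc: "\<And>j. j \<in> J \<Longrightarrow> f j \<in> carrier_vec n"
    using f by (auto simp: binary_parseval_frame_def)
  have fd: "\<And>j. j \<in> J \<Longrightarrow> dim_vec (f j) = n"
    by (rule carrier_vecD[OF fc])
  have "x $ i = finsum_vec TYPE(bit) n (\<lambda>j. (x \<bullet> f j) \<cdot>\<^sub>v f j) J $ i"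
    using f x by (simp add: binary_parseval_frame_def)
  also have "\<dots> = (\<Sum>j\<in>J. ((x \<bullet> f j) \<cdot>\<^sub>v f j) $ i)"
    using fc by (intro index_finsum_vec[OF J i]) auto
  also have "\<dots> = (\<Sum>j\<in>J. (x \<bullet> f j) * f j $ i)"
    using i by (intro sum.cong refl) (simp add: fd)
  finally show ?thesis .
qed

text \<open>Follows by substituting the frame expansion of \<open>x\<close> into the dot product
  with \<open>y\<close> and exchanging the sums.\<close>

lemma parseval_identity:
  assumes f: "binary_parseval_frame n J f" and x: "x \<in> carrier_vec n" and y: "y \<in> carrier_vec n"
  shows "(\<Sum>j\<in>J. (x \<bullet> f j) * (y \<bullet> f j)) = x \<bullet> y"
proof -
  have fc: "\<And>j. j \<in> J \<Longrightarrow> f j \<in> carrier_vec n"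
    using f by (auto simp: binary_parseval_frame_def)
  have fd: "\<And>j. j \<in> J \<Longrightarrow> dim_vec (f j) = n"
    by (rule carrier_vecD[OF fc])
  have "x \<bullet> y = (\<Sum>i<n. (\<Sum>j\<in>J. (x \<bullet> f j) * f j $ i) * y $ i)"
    using y by (simp add: scalar_prod_def parseval_expansion[OF f x] atLeast0LessThan)
  also have "\<dots> = (\<Sum>j\<in>J. \<Sum>i<n. (x \<bullet> f j) * (f j $ i * y $ i))"
    by (simp add: sum_distrib_right mult.assoc) (rule sum.swap)
  also have "\<dots> = (\<Sum>j\<in>J. (x \<bullet> f j) * (y \<bullet> f j))"
    using y by (intro sum.cong refl)
      (simp add: sum_distrib_left scalar_prod_def[of y] atLeast0LessThan fd mult.commute[of "y $ _"])
  finally show ?thesis ..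
qed

text \<open>
  Over the two-element field \<open>x \<bullet> x = 1 \<bullet> x\<close> for the all-ones vector, so a family of
  isotropic vectors is orthogonal to a nonzero vector.
\<close>

lemma parseval_frame_anisotropic:
  assumes f: "binary_parseval_frame n J f" and n: "n \<ge> 1"
  shows "\<exists>j\<in>J. f j \<bullet> f j = 1"
proof (rule ccontr)
  assume neg: "\<not> ?thesis"
  define e :: "bit vec" where "e = vec n (\<lambda>_. 1)"
  have "e \<bullet> f j = 0" if "j \<in> J" for j
  proof -
    have "f j \<in> carrier_vec n"
      using f that by (auto simp: binary_parseval_frame_def)
    then have "dim_vec (f j) = n"
      by (rule carrier_vecD)
    then have "e \<bullet> f j = f j \<bullet> f j"
      by (simp add: e_def scalar_prod_def)
    then show ?thesis
      using neg that by simp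
  qed
  then have "e $ 0 = 0"
    using parseval_expansion[OF f, of e 0] n by (simp add: e_def)
  with n show False
    by (simp add: e_def)
qed

text \<open>For A = \<open>\<rho> h\<close>, Parseval writes A A^T as the sum of f_(hg) f_(hg)^T
  over the group. Translation by \<open>h\<close> only permutes the frame, so this is the identity
  matrix; hence A is orthogonal and preserves dot products.\<close>

lemma group_frame_gram:
  assumes "group \<Gamma>" and f: "binary_parseval_group_frame \<Gamma> n f"
    and h: "h \<in> carrier \<Gamma>" and a: "a \<in> carrier \<Gamma>" and b: "b \<in> carrier \<Gamma>"
  shows "f (h \<otimes>\<^bsub>\<Gamma>\<^esub> b) \<bullet> f (h \<otimes>\<^bsub>\<Gamma>\<^esub> a) = f b \<bullet> f a"
proof -
  interpret group \<Gamma> by fact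
  interpret M: monoid "ring_mat TYPE(bit) n ()"
    using ring_mat by (rule ring.is_monoid)
  have pf: "binary_parseval_frame n (carrier \<Gamma>) f"
    using f by (simp add: binary_parseval_group_frame_def)
  have fc: "f g \<in> carrier_vec n" if "g \<in> carrier \<Gamma>" for g
    using pf that by (auto simp: binary_parseval_frame_def)
  obtain \<rho> where \<rho>: "\<rho> \<in> hom \<Gamma> (binary_GL n)"
    and f\<rho>: "\<And>g. g \<in> carrier \<Gamma> \<Longrightarrow> f g = \<rho> g *\<^sub>v f \<one>\<^bsub>\<Gamma>\<^esub>"
    using f by (auto simp: binary_parseval_group_frame_def)
  have \<rho>U: "\<rho> g \<in> Units (ring_mat TYPE(bit) n ())" if "g \<in> carrier \<Gamma>" for g
    using \<rho> that by (auto simp: hom_def binary_GL_def units_of_carrier)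
  have \<rho>c: "\<rho> g \<in> carrier_mat n n" if "g \<in> carrier \<Gamma>" for g
    using M.Units_closed[OF \<rho>U[OF that]] by (simp add: ring_mat_simps)
  have \<rho>m: "\<rho> (g \<otimes>\<^bsub>\<Gamma>\<^esub> g') = \<rho> g * \<rho> g'" if "g \<in> carrier \<Gamma>" "g' \<in> carrier \<Gamma>" for g g'
    using \<rho> that by (auto simp: hom_def binary_GL_def units_of_mult ring_mat_simps)
  define A where "A = \<rho> h"
  have A: "A \<in> carrier_mat n n" and At: "transpose_mat A \<in> carrier_mat n n"
    using \<rho>c[OF h] by (simp_all add: A_def)
  have Af: "A *\<^sub>v f g = f (h \<otimes>\<^bsub>\<Gamma>\<^esub> g)" if "g \<in> carrier \<Gamma>" for g
    using that h assoc_mult_mat_vec[OF \<rho>c[OF h] \<rho>c[OF that] fc[OF one_closed]]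
    by (simp add: A_def f\<rho>[of g] f\<rho>[of "h \<otimes>\<^bsub>\<Gamma>\<^esub> g"] \<rho>m)
  have row: "row A i \<bullet> f g = f (h \<otimes>\<^bsub>\<Gamma>\<^esub> g) $ i" if "g \<in> carrier \<Gamma>" "i < n" for g i
    using A that by (simp add: Af[symmetric])
  have "A * transpose_mat A = 1\<^sub>m n"
  proof (rule eq_matI)
    fix i j assume "i < dim_row (1\<^sub>m n :: bit mat)" "j < dim_col (1\<^sub>m n :: bit mat)"
    then have i: "i < n" and j: "j < n"
      by simp_all
    have "(A * transpose_mat A) $$ (i, j) = row A i \<bullet> row A j"
      using A i j by simp
    also have "\<dots> = (\<Sum>g\<in>carrier \<Gamma>. (row A i \<bullet> f g) * (row A j \<bullet> f g))"
      using A by (intro parseval_identity[OF pf, symmetric] row_carrier_vec) (use i j in auto)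
    also have "\<dots> = (\<Sum>g\<in>carrier \<Gamma>. f (h \<otimes>\<^bsub>\<Gamma>\<^esub> g) $ i * f (h \<otimes>\<^bsub>\<Gamma>\<^esub> g) $ j)"
      using i j by (simp add: row)
    also have "\<dots> = (\<Sum>g\<in>carrier \<Gamma>. f g $ i * f g $ j)"
      by (rule sum_left_mult[OF h])
    also have "\<dots> = (\<Sum>g\<in>carrier \<Gamma>. (unit_vec n i \<bullet> f g) * (unit_vec n j \<bullet> f g))"
      using i j fc by simp
    also have "\<dots> = unit_vec n i \<bullet> unit_vec n j"
      by (rule parseval_identity[OF pf]) simp_all
    also have "\<dots> = 1\<^sub>m n $$ (i, j)"
      using i j by simp
    finally show "(A * transpose_mat A) $$ (i, j) = 1\<^sub>m n $$ (i, j)" .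
  qed (use A in auto)
  \<comment> \<open>Invertibility of \<open>A\<close> turns the right inverse A^T into a two-sided
    one: A^T = B A A^T = B.\<close>
  moreover obtain B where "B \<in> carrier_mat n n" "B * A = 1\<^sub>m n"
    using \<rho>U[OF h] by (auto simp: Units_def ring_mat_simps A_def)
  ultimately have "transpose_mat A * A = 1\<^sub>m n"
    using A At assoc_mult_mat[of B n n A n "transpose_mat A" n] by simp
  then have "(A *\<^sub>v f b) \<bullet> (A *\<^sub>v f a) = f b \<bullet> f a"
    using A At fc[OF a] fc[OF b] transpose_vec_mult_scalar[OF A fc[OF a], of "A *\<^sub>v f b"]
    by (simp add: assoc_mult_mat_vec[OF At A, symmetric])
  then show ?thesis
    by (simp add: Af a b)
qed

text \<open>The vectors are the coordinates of the columns of \<open>P\<close> in the orthonormal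
  basis \<open>U i\<close>. Orthonormality yields the Parseval property; invariance of
  \<open>P\<close> makes translations preserve its range and so act on the coordinates.\<close>

lemma group_frame_of_factorization:
  assumes "group \<Gamma>" and fin: "finite (carrier \<Gamma>)"
    and U: "\<And>i j. i < n \<Longrightarrow> j < n \<Longrightarrow> dot (carrier \<Gamma>) (U i) (U j) = of_bool (i = j)"
    and PU: "\<And>a b. a \<in> carrier \<Gamma> \<Longrightarrow> b \<in> carrier \<Gamma> \<Longrightarrow> P a b = (\<Sum>i<n. U i a * U i b)"
    and inv: "\<And>g a b. g \<in> carrier \<Gamma> \<Longrightarrow> a \<in> carrier \<Gamma> \<Longrightarrow> b \<in> carrier \<Gamma> \<Longrightarrow>
      P (g \<otimes>\<^bsub>\<Gamma>\<^esub> a) (g \<otimes>\<^bsub>\<Gamma>\<^esub> b) = P a b"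
  shows "binary_parseval_group_frame \<Gamma> n (\<lambda>g. vec n (\<lambda>i. U i g))"
proof -
  interpret group \<Gamma> by fact
  interpret M: monoid "ring_mat TYPE(bit) n ()"
    using ring_mat by (rule ring.is_monoid)
  let ?S = "carrier \<Gamma>"
  define f where "f = (\<lambda>g. vec n (\<lambda>i. U i g))"
  have fc: "f g \<in> carrier_vec n" for g
    by (simp add: f_def)
  \<comment> \<open>Each \<open>U i\<close> lies in the range of \<open>P\<close>: by orthonormality
    a single term survives.\<close>
  have fixed: "(\<Sum>a\<in>?S. U i a * P a b) = U i b" if "i < n" "b \<in> ?S" for i b
  proof -
    have "(\<Sum>a\<in>?S. U i a * P a b) = (\<Sum>a\<in>?S. \<Sum>j<n. U i a * (U j a * U j b))"
      using that by (simp add: PU sum_distrib_left)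
    also have "\<dots> = (\<Sum>j<n. dot ?S (U i) (U j) * U j b)"
      by (subst sum.swap) (simp add: dot_def sum_distrib_right mult.assoc)
    also have "\<dots> = (\<Sum>j<n. if i = j then U j b else 0)"
      using that by (intro sum.cong refl) (simp add: U)
    also have "\<dots> = U i b"
      using that by simp
    finally show ?thesis .
  qed
  have "binary_parseval_frame n ?S f"
    unfolding binary_parseval_frame_def
  proof (intro conjI ballI)
    fix x :: "bit vec" assume x: "x \<in> carrier_vec n"
    show "x = finsum_vec TYPE(bit) n (\<lambda>j. (x \<bullet> f j) \<cdot>\<^sub>v f j) ?S"
    proof (rule eq_vecI)
      have c: "(\<lambda>j. (x \<bullet> f j) \<cdot>\<^sub>v f j) \<in> ?S \<rightarrow> carrier_vec n"
        using fc by simp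
      then have d: "dim_vec (finsum_vec TYPE(bit) n (\<lambda>j. (x \<bullet> f j) \<cdot>\<^sub>v f j) ?S) = n"
        using finsum_vec_closed carrier_dim_vec by blast
      show "dim_vec x = dim_vec (finsum_vec TYPE(bit) n (\<lambda>j. (x \<bullet> f j) \<cdot>\<^sub>v f j) ?S)"
        using x d by simp
      fix i assume "i < dim_vec (finsum_vec TYPE(bit) n (\<lambda>j. (x \<bullet> f j) \<cdot>\<^sub>v f j) ?S)"
      with d have i: "i < n" by simp
      have "finsum_vec TYPE(bit) n (\<lambda>j. (x \<bullet> f j) \<cdot>\<^sub>v f j) ?S $ i =
          (\<Sum>g\<in>?S. (\<Sum>j<n. x $ j * U j g) * U i g)"
        unfolding index_finsum_vec[OF fin i c]
        using i by (intro sum.cong refl) (simp add: f_def scalar_prod_def atLeast0LessThan)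
      also have "\<dots> = (\<Sum>j<n. x $ j * dot ?S (U j) (U i))"
        by (simp add: sum_distrib_right dot_def sum_distrib_left mult.assoc) (rule sum.swap)
      also have "\<dots> = (\<Sum>j<n. if j = i then x $ j else 0)"
        using i by (intro sum.cong refl) (simp add: U)
      also have "\<dots> = x $ i"
        using i by simp
      finally show "x $ i = finsum_vec TYPE(bit) n (\<lambda>j. (x \<bullet> f j) \<cdot>\<^sub>v f j) ?S $ i" ..
    qed
  qed (use fin fc in auto)
  \<comment> \<open>The matrix of left translation by \<open>g\<close> on the range of
    \<open>P\<close>, in the basis \<open>U i\<close>.\<close>
  moreover define \<rho> where
    "\<rho> g = mat n n (\<lambda>(i, j). \<Sum>a\<in>?S. U i (g \<otimes>\<^bsub>\<Gamma>\<^esub> a) * U j a)" for g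
  have \<rho>c: "\<rho> g \<in> carrier_mat n n" for g
    by (simp add: \<rho>_def)
  \<comment> \<open>Coordinatewise, \<open>\<rho> g\<close> maps the frame vector at
    \<open>b\<close> to the one at g b. Summing over \<open>j\<close> produces \<open>P a b\<close>,
    which invariance rewrites as P (g a) (g b) before the sum over \<open>a\<close> is
    translated.\<close>
  have act: "(\<Sum>j<n. (\<Sum>a\<in>?S. U i (g \<otimes>\<^bsub>\<Gamma>\<^esub> a) * U j a) * U j b) = U i (g \<otimes>\<^bsub>\<Gamma>\<^esub> b)"
    if "i < n" "g \<in> ?S" "b \<in> ?S" for i g b
  proof -
    have "(\<Sum>j<n. (\<Sum>a\<in>?S. U i (g \<otimes>\<^bsub>\<Gamma>\<^esub> a) * U j a) * U j b) =
        (\<Sum>a\<in>?S. \<Sum>j<n. U i (g \<otimes>\<^bsub>\<Gamma>\<^esub> a) * (U j a * U j b))"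
      by (simp add: sum_distrib_right mult.assoc) (rule sum.swap)
    also have "\<dots> = (\<Sum>a\<in>?S. U i (g \<otimes>\<^bsub>\<Gamma>\<^esub> a) * P (g \<otimes>\<^bsub>\<Gamma>\<^esub> a) (g \<otimes>\<^bsub>\<Gamma>\<^esub> b))"
      using that by (intro sum.cong refl) (simp only: inv PU sum_distrib_left)
    also have "\<dots> = (\<Sum>a\<in>?S. U i a * P a (g \<otimes>\<^bsub>\<Gamma>\<^esub> b))"
      using sum_left_mult[OF that(2), of "\<lambda>a. U i a * P a (g \<otimes>\<^bsub>\<Gamma>\<^esub> b)"] .
    also have "\<dots> = U i (g \<otimes>\<^bsub>\<Gamma>\<^esub> b)"
      using that by (intro fixed) simp_all
    finally show ?thesis .
  qed
  have \<rho>m: "\<rho> (g \<otimes>\<^bsub>\<Gamma>\<^esub> h) = \<rho> g * \<rho> h" if "g \<in> ?S" "h \<in> ?S" for g h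
  proof (rule eq_matI)
    fix i k assume "i < dim_row (\<rho> g * \<rho> h)" "k < dim_col (\<rho> g * \<rho> h)"
    then have i: "i < n" and k: "k < n"
      by (simp_all add: \<rho>_def)
    have "(\<rho> g * \<rho> h) $$ (i, k) = (\<Sum>j<n. (\<Sum>a\<in>?S. U i (g \<otimes>\<^bsub>\<Gamma>\<^esub> a) * U j a) *
        (\<Sum>b\<in>?S. U j (h \<otimes>\<^bsub>\<Gamma>\<^esub> b) * U k b))"
      using i k by (simp add: \<rho>_def scalar_prod_def atLeast0LessThan)
    \<comment> \<open>Exchanging the sums exposes the action of \<open>\<rho> g\<close> on the frame
      vector at h b, so that \<open>act\<close> applies.\<close>
    also have "\<dots> = (\<Sum>b\<in>?S. (\<Sum>j<n. (\<Sum>a\<in>?S. U i (g \<otimes>\<^bsub>\<Gamma>\<^esub> a) * U j a) *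
        U j (h \<otimes>\<^bsub>\<Gamma>\<^esub> b)) * U k b)"
      unfolding sum_distrib_left[where A = ?S] sum_distrib_right[where A = "{..<n}"] mult.assoc
      by (rule sum.swap)
    also have "\<dots> = (\<Sum>b\<in>?S. U i (g \<otimes>\<^bsub>\<Gamma>\<^esub> h \<otimes>\<^bsub>\<Gamma>\<^esub> b) * U k b)"
      using that i by (intro sum.cong refl) (simp only: act m_closed m_assoc)
    finally show "\<rho> (g \<otimes>\<^bsub>\<Gamma>\<^esub> h) $$ (i, k) = (\<rho> g * \<rho> h) $$ (i, k)"
      using i k by (simp add: \<rho>_def)
  qed (simp_all add: \<rho>_def)
  have \<rho>1: "\<rho> \<one>\<^bsub>\<Gamma>\<^esub> = 1\<^sub>m n"
    using U by (intro eq_matI) (simp_all add: \<rho>_def dot_def)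
  have "\<rho> g \<in> Units (ring_mat TYPE(bit) n ())" if "g \<in> ?S" for g
    using that \<rho>c \<rho>m[of g "inv\<^bsub>\<Gamma>\<^esub> g"] \<rho>m[of "inv\<^bsub>\<Gamma>\<^esub> g" g]
    by (auto simp: Units_def ring_mat_simps \<rho>1 intro!: bexI[of _ "\<rho> (inv\<^bsub>\<Gamma>\<^esub> g)"])
  then have "\<rho> \<in> hom \<Gamma> (binary_GL n)"
    by (auto simp: hom_def binary_GL_def units_of_carrier units_of_mult ring_mat_simps \<rho>m)
  moreover have "f g = \<rho> g *\<^sub>v f \<one>\<^bsub>\<Gamma>\<^esub>" if "g \<in> ?S" for g
    using that act[of _ g "\<one>\<^bsub>\<Gamma>\<^esub>"]
    by (intro eq_vecI) (simp_all add: f_def \<rho>_def scalar_prod_def atLeast0LessThan)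
  ultimately show ?thesis
    unfolding binary_parseval_group_frame_def f_def by blast
qed

section \<open>Gram functions over abelian groups of odd order\<close>

text \<open>Translation invariance reduces the Gramian to one function on the group. Symmetry of the
  dot product gives its invariance under inversion, the Parseval identity that under squaring, and a
  non-isotropic frame vector, moved to the identity, the value 1 there.\<close>

lemma (in comm_group) group_frame_gram_function:
  assumes fin: "finite (carrier G)" "odd (order G)"
    and n: "n \<ge> 1" and f: "binary_parseval_group_frame G n f"
  shows "f \<one> \<bullet> f \<one> = 1"
    and "a \<in> carrier G \<Longrightarrow> b \<in> carrier G \<Longrightarrow> f b \<bullet> f a = f (inv a \<otimes> b) \<bullet> f \<one>"
    and "g \<in> carrier G \<Longrightarrow> f (inv g) \<bullet> f \<one> = f g \<bullet> f \<one>"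
    and "g \<in> carrier G \<Longrightarrow> f (g \<otimes> g) \<bullet> f \<one> = f g \<bullet> f \<one>"
proof -
  have pf: "binary_parseval_frame n (carrier G) f"
    using f by (simp add: binary_parseval_group_frame_def)
  have fc: "f g \<in> carrier_vec n" if "g \<in> carrier G" for g
    using pf that by (auto simp: binary_parseval_frame_def)
  show gram: "f b \<bullet> f a = f (inv a \<otimes> b) \<bullet> f \<one>" if "a \<in> carrier G" "b \<in> carrier G" for a b
    using group_frame_gram[OF is_group f, of "inv a" a b] that by simp
  show "f \<one> \<bullet> f \<one> = 1"
  proof -
    obtain j where "j \<in> carrier G" "f j \<bullet> f j = 1"
      using parseval_frame_anisotropic[OF pf n] by blast
    then show ?thesis
      using gram[of j j] by simp
  qed
  show "f (inv g) \<bullet> f \<one> = f g \<bullet> f \<one>" if g: "g \<in> carrier G"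
    using gram[OF g one_closed] comm_scalar_prod[OF fc[OF g] fc[OF one_closed]] g by simp
  show "f (g \<otimes> g) \<bullet> f \<one> = f g \<bullet> f \<one>" if g: "g \<in> carrier G"
  proof -
    \<comment> \<open>The Parseval identity for these two vectors is a convolution of the Gram
      function with itself, evaluated at a square.\<close>
    have "f (g \<otimes> g) \<bullet> f \<one> = (\<Sum>c\<in>carrier G. (f (g \<otimes> g) \<bullet> f c) * (f \<one> \<bullet> f c))"
      using g by (intro parseval_identity[OF pf, symmetric] fc) auto
    also have "\<dots> = (\<Sum>c\<in>carrier G. (f (inv c \<otimes> (g \<otimes> g)) \<bullet> f \<one>) * (f c \<bullet> f \<one>))"
    proof (intro sum.cong refl)
      fix c assume c: "c \<in> carrier G"
      then show "(f (g \<otimes> g) \<bullet> f c) * (f \<one> \<bullet> f c) =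
          (f (inv c \<otimes> (g \<otimes> g)) \<bullet> f \<one>) * (f c \<bullet> f \<one>)"
        using gram[OF c, of "g \<otimes> g"] comm_scalar_prod[OF fc[OF c] fc[OF one_closed]] g by simp
    qed
    also have "\<dots> = f g \<bullet> f \<one>"
      by (rule convolution_square[OF fin g])
    finally show ?thesis .
  qed
qed

text \<open>The entry of the squared matrix at (a, b) is the convolution of \<open>\<eta>\<close>
  with itself at a^-1 b. It collapses to the value of \<open>\<eta>\<close> at the square root of
  that element, which invariance under squaring carries back.\<close>

lemma (in comm_group) orth_projection_convolution:
  fixes \<eta> :: "'a \<Rightarrow> bit"
  assumes fin: "finite (carrier G)" "odd (order G)"
    and double: "\<And>x. x \<in> carrier G \<Longrightarrow> \<eta> (x \<otimes> x) = \<eta> x"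
    and inv: "\<And>x. x \<in> carrier G \<Longrightarrow> \<eta> (inv x) = \<eta> x"
  shows "orth_projection (carrier G) (\<lambda>a b. \<eta> (inv a \<otimes> b))"
  unfolding orth_projection_def
proof (intro ballI conjI)
  fix a b assume a: "a \<in> carrier G" and b: "b \<in> carrier G"
  have swap: "\<eta> (inv x \<otimes> y) = \<eta> (inv y \<otimes> x)" if "x \<in> carrier G" "y \<in> carrier G" for x y
    using inv[of "inv x \<otimes> y"] that by (simp add: inv_mult_group)
  show "\<eta> (inv a \<otimes> b) = \<eta> (inv b \<otimes> a)"
    by (rule swap[OF a b])
  define g where "g = inv a \<otimes> b"
  have g: "g \<in> carrier G"
    using a b by (simp add: g_def)
  obtain j :: nat
    where j: "\<And>x. x \<in> carrier G \<Longrightarrow> (x [^] ((2::nat) ^ 1)) [^] ((2::nat) ^ j) = x"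
    using iterated_doubling_inverse[OF fin] by blast
  \<comment> \<open>The square root of \<open>g\<close>: raising to the power 2^j undoes
    squaring.\<close>
  define k where "k = g [^] ((2::nat) ^ j)"
  have k: "k \<in> carrier G"
    using g by (simp add: k_def)
  have "k \<otimes> k = g [^] ((2::nat) ^ j + 2 ^ j)"
    using g by (simp add: k_def nat_pow_mult)
  also have "\<dots> = (g [^] ((2::nat) ^ 1)) [^] ((2::nat) ^ j)"
    using g by (simp only: nat_pow_pow mult_2 power_one_right)
  also have "\<dots> = g"
    by (rule j[OF g])
  finally have kk: "k \<otimes> k = g" .
  have "dot (carrier G) (\<lambda>b. \<eta> (inv a \<otimes> b)) (\<lambda>ba. \<eta> (inv b \<otimes> ba)) =
      (\<Sum>c\<in>carrier G. \<eta> (inv (inv a \<otimes> c) \<otimes> g) * \<eta> (inv a \<otimes> c))"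
    unfolding dot_def
  proof (intro sum.cong refl)
    fix c assume c: "c \<in> carrier G"
    have "inv (inv a \<otimes> c) \<otimes> g = inv c \<otimes> (a \<otimes> (inv a \<otimes> b))"
      using a b c by (simp add: g_def inv_mult_group m_assoc)
    also have "\<dots> = inv c \<otimes> b"
      using a b c by (simp add: m_assoc[symmetric])
    finally show "\<eta> (inv a \<otimes> c) * \<eta> (inv b \<otimes> c) =
        \<eta> (inv (inv a \<otimes> c) \<otimes> g) * \<eta> (inv a \<otimes> c)"
      using swap[OF b c] by (simp add: mult.commute)
  qed
  also have "\<dots> = (\<Sum>c\<in>carrier G. \<eta> (inv c \<otimes> g) * \<eta> c)"
    using sum_left_mult[of "inv a" "\<lambda>c. \<eta> (inv c \<otimes> g) * \<eta> c"] a by simp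
  also have "\<dots> = \<eta> k"
    using convolution_square[OF fin k, of \<eta>] kk by simp
  also have "\<dots> = \<eta> (inv a \<otimes> b)"
    using double[OF k] kk by (simp add: g_def)
  finally show "dot (carrier G) (\<lambda>b. \<eta> (inv a \<otimes> b)) (\<lambda>ba. \<eta> (inv b \<otimes> ba)) = \<eta> (inv a \<otimes> b)" .
qed

lemma (in comm_group) group_frame_of_gram_function:
  fixes \<eta> :: "'a \<Rightarrow> bit"
  assumes fin: "finite (carrier G)" "odd (order G)" and one: "\<eta> \<one> = 1"
    and double: "\<And>x. x \<in> carrier G \<Longrightarrow> \<eta> (x \<otimes> x) = \<eta> x"
    and inv: "\<And>x. x \<in> carrier G \<Longrightarrow> \<eta> (inv x) = \<eta> x"
  obtains n f where "n \<ge> 1" "binary_parseval_group_frame G n f"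
    "\<And>a b. a \<in> carrier G \<Longrightarrow> b \<in> carrier G \<Longrightarrow> f b \<bullet> f a = \<eta> (inv a \<otimes> b)"
proof -
  let ?P = "\<lambda>a b. \<eta> (inv a \<otimes> b)"
  have P: "orth_projection (carrier G) ?P"
    using fin double inv by (rule orth_projection_convolution)
  \<comment> \<open>The factorization starts from a unit vector in the range. The row at the
    identity is one, since by idempotence its square is the diagonal entry
    \<open>\<eta> \<one>\<close>.\<close>
  have "dot (carrier G) (?P \<one>) (?P \<one>) = 1"
    using P[unfolded orth_projection_def, rule_format, OF one_closed one_closed] one
    by (simp only: inv_one r_one one_closed)
  from orth_projection_factorization[OF fin(1) P fixed_by_row[OF P one_closed] this]
  obtain n and U :: "nat \<Rightarrow> 'a \<Rightarrow> bit" where n: "n \<ge> 1"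
    and U: "\<And>i j. i < n \<Longrightarrow> j < n \<Longrightarrow> dot (carrier G) (U i) (U j) = of_bool (i = j)"
    and PU: "\<And>a b. a \<in> carrier G \<Longrightarrow> b \<in> carrier G \<Longrightarrow> ?P a b = (\<Sum>i<n. U i a * U i b)"
    by blast
  have "inv (g \<otimes> a) \<otimes> (g \<otimes> b) = inv a \<otimes> b"
    if "g \<in> carrier G" "a \<in> carrier G" "b \<in> carrier G" for g a b
  proof -
    have "inv (g \<otimes> a) \<otimes> (g \<otimes> b) = inv a \<otimes> (inv g \<otimes> (g \<otimes> b))"
      using that by (simp add: inv_mult_group m_assoc)
    also have "\<dots> = inv a \<otimes> b"
      using that by (simp add: m_assoc[symmetric])
    finally show ?thesis .
  qed
  then have "binary_parseval_group_frame G n (\<lambda>g. vec n (\<lambda>i. U i g))"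
    by (intro group_frame_of_factorization[OF is_group fin(1) U PU]) simp_all
  moreover have "vec n (\<lambda>i. U i b) \<bullet> vec n (\<lambda>i. U i a) = \<eta> (inv a \<otimes> b)"
    if "a \<in> carrier G" "b \<in> carrier G" for a b
    using PU[OF that] by (simp add: scalar_prod_def atLeast0LessThan mult.commute)
  ultimately show thesis
    by (rule that[OF n])
qed

theorem theorem3p16:
  fixes \<Gamma> :: "('g, 'x) monoid_scheme"
    and J :: "'g set"
    and G :: "('g \<Rightarrow> bit) \<Rightarrow> ('g \<Rightarrow> bit)"
  assumes "comm_group \<Gamma>"
    and "finite (carrier \<Gamma>)"
    and "odd (order \<Gamma>)"
    and "sym_doubling_orbit_representatives \<Gamma> J"
    and "linear_map \<Gamma> G"
  shows "(\<exists>n\<ge>1. \<exists>f. binary_parseval_group_frame \<Gamma> n f \<and> is_gramian \<Gamma> f G) \<longleftrightarrow>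
    (\<exists>\<nu> :: 'g set \<Rightarrow> bit.
       \<nu> (sym_doubling_orbit \<Gamma> \<one>\<^bsub>\<Gamma>\<^esub>) = 1 \<and>
       (\<forall>\<phi> \<in> fun_space \<Gamma>.
          G \<phi> = (\<lambda>a. \<Sum>g\<in>J. \<nu> (sym_doubling_orbit \<Gamma> g) *
                       right_regular_sum \<Gamma> (sym_doubling_orbit \<Gamma> g) \<phi> a)))"
    (is "?frame \<longleftrightarrow> ?orbit_sum")
proof -
  interpret comm_group \<Gamma> by fact
  note fin = assms(2,3)
  \<comment> \<open>With this, both directions only compare matrix entries.\<close>
  have orbit_sum_iff: "(\<forall>\<phi> \<in> fun_space \<Gamma>.
      G \<phi> = (\<lambda>a. \<Sum>g\<in>J. \<nu> (sym_doubling_orbit \<Gamma> g) *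
        right_regular_sum \<Gamma> (sym_doubling_orbit \<Gamma> g) \<phi> a)) \<longleftrightarrow>
      (\<forall>a \<in> carrier \<Gamma>. \<forall>b \<in> carrier \<Gamma>.
        G (std_basis b) a = \<nu> (sym_doubling_orbit \<Gamma> (inv\<^bsub>\<Gamma>\<^esub> a \<otimes>\<^bsub>\<Gamma>\<^esub> b)))" for \<nu>
    unfolding sum_orbits_right_regular[OF fin assms(4)]
    by (rule linear_map_matrix_iff[OF assms(2,5)])
  show ?thesis
  proof
    assume ?frame
    then obtain n f where n: "n \<ge> 1" and f: "binary_parseval_group_frame \<Gamma> n f"
      and G: "is_gramian \<Gamma> f G"
      by blast
    note gram = group_frame_gram_function[OF fin n f]
    \<comment> \<open>\<open>\<eta>\<close> will be constant on orbits, so any element of an orbit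
      decides its weight and no representative has to be chosen.\<close>
    define \<eta> where "\<eta> g = f g \<bullet> f \<one>\<^bsub>\<Gamma>\<^esub>" for g
    define \<nu> :: "'g set \<Rightarrow> bit" where "\<nu> S = of_bool (\<exists>h\<in>S. \<eta> h = 1)" for S
    have \<nu>: "\<nu> (sym_doubling_orbit \<Gamma> g) = \<eta> g" if g: "g \<in> carrier \<Gamma>" for g
    proof -
      have "\<eta> h = \<eta> g" if "h \<in> sym_doubling_orbit \<Gamma> g" for h
        using gram(4) gram(3) g that unfolding \<eta>_def by (rule constant_on_sym_doubling_orbit)
      then show ?thesis
        using sym_doubling_orbit_self[OF g] by (cases "\<eta> g") (auto simp: \<nu>_def)
    qed
    have "\<nu> (sym_doubling_orbit \<Gamma> \<one>\<^bsub>\<Gamma>\<^esub>) = 1"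
      using gram(1) by (simp add: \<nu> \<eta>_def)
    moreover have "G (std_basis b) a = \<nu> (sym_doubling_orbit \<Gamma> (inv\<^bsub>\<Gamma>\<^esub> a \<otimes>\<^bsub>\<Gamma>\<^esub> b))"
      if "a \<in> carrier \<Gamma>" "b \<in> carrier \<Gamma>" for a b
      using G gram(2)[OF that] that by (simp add: is_gramian_def \<nu> \<eta>_def)
    ultimately show ?orbit_sum
      unfolding orbit_sum_iff by blast
  next
    assume ?orbit_sum
    then obtain \<nu> :: "'g set \<Rightarrow> bit" where one: "\<nu> (sym_doubling_orbit \<Gamma> \<one>\<^bsub>\<Gamma>\<^esub>) = 1"
      and G: "\<And>a b. a \<in> carrier \<Gamma> \<Longrightarrow> b \<in> carrier \<Gamma> \<Longrightarrow>
        G (std_basis b) a = \<nu> (sym_doubling_orbit \<Gamma> (inv\<^bsub>\<Gamma>\<^esub> a \<otimes>\<^bsub>\<Gamma>\<^esub> b))"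
      unfolding orbit_sum_iff by blast
    \<comment> \<open>The orbit of \<open>x\<close> contains the square and the inverse of
      \<open>x\<close>, so the orbit weight, as a function on the group, is invariant under both
      operations.\<close>
    have "x \<otimes>\<^bsub>\<Gamma>\<^esub> x \<in> sym_doubling_orbit \<Gamma> x" if "x \<in> carrier \<Gamma>" for x
      unfolding mem_sym_doubling_orbit_iff[OF that]
      using that by (intro exI[of _ 1] disjI1) (simp add: numeral_2_eq_2)
    moreover have "inv\<^bsub>\<Gamma>\<^esub> x \<in> sym_doubling_orbit \<Gamma> x" if "x \<in> carrier \<Gamma>" for x
      unfolding mem_sym_doubling_orbit_iff[OF that]
      using that by (intro exI[of _ 0] disjI2) simp
    ultimately obtain n f where n: "n \<ge> 1" and f: "binary_parseval_group_frame \<Gamma> n f"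
      and gram: "\<And>a b. a \<in> carrier \<Gamma> \<Longrightarrow> b \<in> carrier \<Gamma> \<Longrightarrow>
        f b \<bullet> f a = \<nu> (sym_doubling_orbit \<Gamma> (inv\<^bsub>\<Gamma>\<^esub> a \<otimes>\<^bsub>\<Gamma>\<^esub> b))"
      using group_frame_of_gram_function[OF fin, of "\<lambda>g. \<nu> (sym_doubling_orbit \<Gamma> g)"]
        one sym_doubling_orbit_eq[OF fin] by metis
    have "is_gramian \<Gamma> f G"
      unfolding is_gramian_def using assms(5) by (simp add: G gram)
    with n f show ?frame
      by blast
  qed
qed

end
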